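(* Let $n$ be odd and let $X=(X_{ij})$ be the $n\times n$ matrix of indeterminates. Then $AT(n)\cdot(R_n^{\mathrm{E}}-R_n^{\mathrm{O}})$ is the coefficient of $(-1)^{\frac{n(n-1)}{2}}\prod_{i=1}^n\prod_{j=1}^nX_{ij}$ in \[ \frac{1}{n!\,(n-1)!^2}\sum_{\substack{\rho,\sigma\in\mathrm{Sym}(n)^n\\ \rho_1=\mathrm{id}}}\epsilon(\sigma_1)\epsilon(\sigma)\epsilon(\rho)\prod_{i,j=1}^nX_{\sigma_i(j),\rho_j(i)}; \] that is, the coefficient of the monomial $\prod_{i,j}X_{ij}$ in this polynomial equals $(-1)^{\frac{n(n-1)}{2}}AT(n)(R_n^{\mathrm{E}}-R_n^{\mathrm{O}})$.
   Context: $\mathrm{Sym}(n)$ is the symmetric group on $[n]=\{1,\dots,n\}$ and $\epsilon(\pi)$ the sign of $\pi$. For $\sigma=(\sigma_1,\dots,\sigma_n)\in\mathrm{Sym}(n)^n$, $\sigma_1$ is its first component and $\epsilon(\sigma)=\prod_{i=1}^n\epsilon(\sigma_i)$ (similarly for $\rho$). A Latin square of order $n$ is an $n\times n$ array with entries in $[n]$ in which each number appears exactly once in each row and each column. Viewing rows and columns as permutations of $[n]$, the sign of a Latin square is the product of the signs of all its rows and all its columns; it is even if its sign is $1$ and odd if $-1$. A Latin square is normalized if its first row is the identity permutation, unipotent if all entries on its main diagonal are equal, and reduced if its first row and first column are the identity permutation. $AT(n)=U_n^{\mathrm{E}}-U_n^{\mathrm{O}}$, where $U_n^{\mathrm{E}}$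 ($U_n^{\mathrm{O}}$) is the number of normalized unipotent even (odd) Latin squares of order $n$; $R_n^{\mathrm{E}}$ ($R_n^{\mathrm{O}}$) is the number of even (odd) reduced Latin squares of order $n$. *)

theory Defs
  imports
    Complex_Main
    "HOL-Library.FuncSet"
    "HOL-Library.Poly_Mapping"
    "HOL-Combinatorics.Permutations"
begin

definition Sym :: "nat \<Rightarrow> (nat \<Rightarrow> nat) set"
  where "Sym n = {p. p permutes {1..n}}"

definition Sym_tuples :: "nat \<Rightarrow> (nat \<Rightarrow> nat \<Rightarrow> nat) set"
  where "Sym_tuples n = {1..n} \<rightarrow>\<^sub>E Sym n"

definition tuple_sign :: "nat \<Rightarrow> (nat \<Rightarrow> nat \<Rightarrow> nat) \<Rightarrow> int"
  where "tuple_sign n \<sigma> = (\<Prod>i\<in>{1..n}. sign (\<sigma> i))"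

text \<open>
  The entry of the array \<open>L\<close> in row \<open>i\<close> and column \<open>j\<close> is \<open>L (i, j)\<close>. Arrays are extensional
  functions (undefined outside the index set), so that cardinalities count actual arrays.
\<close>

definition latin_squares :: "nat \<Rightarrow> (nat \<times> nat \<Rightarrow> nat) set"
  where "latin_squares n = {L \<in> {1..n} \<times> {1..n} \<rightarrow>\<^sub>E {1..n}.
    (\<forall>i\<in>{1..n}. \<forall>k\<in>{1..n}. \<exists>!j. j \<in> {1..n} \<and> L (i, j) = k) \<and>
    (\<forall>j\<in>{1..n}. \<forall>k\<in>{1..n}. \<exists>!i. i \<in> {1..n} \<and> L (i, j) = k)}"

definition row_perm :: "nat \<Rightarrow> (nat \<times> nat \<Rightarrow> nat) \<Rightarrow> nat \<Rightarrow> nat \<Rightarrow> nat"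
  where "row_perm n L i = restrict_id (\<lambda>j. L (i, j)) {1..n}"

definition col_perm :: "nat \<Rightarrow> (nat \<times> nat \<Rightarrow> nat) \<Rightarrow> nat \<Rightarrow> nat \<Rightarrow> nat"
  where "col_perm n L j = restrict_id (\<lambda>i. L (i, j)) {1..n}"

definition latin_sign :: "nat \<Rightarrow> (nat \<times> nat \<Rightarrow> nat) \<Rightarrow> int"
  where "latin_sign n L =
    (\<Prod>i\<in>{1..n}. sign (row_perm n L i)) * (\<Prod>j\<in>{1..n}. sign (col_perm n L j))"

definition latin_even :: "nat \<Rightarrow> (nat \<times> nat \<Rightarrow> nat) \<Rightarrow> bool"
  where "latin_even n L \<longleftrightarrow> latin_sign n L = 1"

definition latin_odd :: "nat \<Rightarrow> (nat \<times> nat \<Rightarrow> nat) \<Rightarrow> bool"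
  where "latin_odd n L \<longleftrightarrow> latin_sign n L = -1"

definition normalized :: "nat \<Rightarrow> (nat \<times> nat \<Rightarrow> nat) \<Rightarrow> bool"
  where "normalized n L \<longleftrightarrow> row_perm n L 1 = id"

definition unipotent :: "nat \<Rightarrow> (nat \<times> nat \<Rightarrow> nat) \<Rightarrow> bool"
  where "unipotent n L \<longleftrightarrow> (\<forall>i\<in>{1..n}. \<forall>j\<in>{1..n}. L (i, i) = L (j, j))"

definition reduced :: "nat \<Rightarrow> (nat \<times> nat \<Rightarrow> nat) \<Rightarrow> bool"
  where "reduced n L \<longleftrightarrow> row_perm n L 1 = id \<and> col_perm n L 1 = id"

definition U_even :: "nat \<Rightarrow> nat"
  where "U_even n =
    card {L \<in> latin_squares n. normalized n L \<and> unipotent n L \<and> latin_even n L}"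

definition U_odd :: "nat \<Rightarrow> nat"
  where "U_odd n =
    card {L \<in> latin_squares n. normalized n L \<and> unipotent n L \<and> latin_odd n L}"

definition AT :: "nat \<Rightarrow> int"
  where "AT n = int (U_even n) - int (U_odd n)"

definition R_even :: "nat \<Rightarrow> nat"
  where "R_even n = card {L \<in> latin_squares n. reduced n L \<and> latin_even n L}"

definition R_odd :: "nat \<Rightarrow> nat"
  where "R_odd n = card {L \<in> latin_squares n. reduced n L \<and> latin_odd n L}"

text \<open>
  Polynomials in indeterminates indexed by \<open>'v\<close>: finitely supported maps from monomials, that is,
  finitely supported exponent vectors, to coefficients. The library's multiplication on such
  maps is convolution, which is the product of polynomials.
\<close>

type_synonym ('v, 'a) mpoly = "('v \<Rightarrow>\<^sub>0 nat) \<Rightarrow>\<^sub>0 'a"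

definition Const :: "'a \<Rightarrow> ('v, 'a::zero) mpoly"
  where "Const c = Poly_Mapping.single 0 c"

definition Var :: "'v \<Rightarrow> ('v, 'a::zero_neq_one) mpoly"
  where "Var v = Poly_Mapping.single (Poly_Mapping.single v 1) 1"

definition mcoeff :: "('v, 'a::zero) mpoly \<Rightarrow> ('v \<Rightarrow>\<^sub>0 nat) \<Rightarrow> 'a"
  where "mcoeff p m = Poly_Mapping.lookup p m"

text \<open>The exponent vector of the product of all \<open>X\<^sub>i\<^sub>j\<close> with \<open>1 \<le> i, j \<le> n\<close>.\<close>

definition all_ones_monomial :: "nat \<Rightarrow> (nat \<times> nat \<Rightarrow>\<^sub>0 nat)"
  where "all_ones_monomial n = (\<Sum>i\<in>{1..n}. \<Sum>j\<in>{1..n}. Poly_Mapping.single (i, j) 1)"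

end

theory Submission
  imports Defs
begin

text \<open>
  A pair \<open>(\<rho>, \<sigma>)\<close> contributes to the coefficient iff \<open>(i, j) \<mapsto> (\<sigma> i j, \<rho> j i)\<close> is a bijection of
  \<open>{1..n} \<times> {1..n}\<close>. If some column of \<open>\<sigma>\<close> other than the first has a repeated entry, the
  contributions for this \<open>\<sigma>\<close> cancel in pairs; since the rows of \<open>\<sigma>\<close> are permutations, what survives
  are the Latin squares \<open>L\<close>. For such an \<open>L\<close> with columns \<open>c j\<close>, the permutations \<open>\<rho> j \<circ> inv (c j)\<close>
  are the rows of a second Latin square \<open>M\<close> with first row \<open>inv (c 1)\<close>, and this is a bijection
  between the contributing \<open>\<rho>\<close> and such \<open>M\<close>. As \<open>n\<close> is odd, relabelling the symbols of \<open>M\<close> to normalize its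
  first row costs the factor \<open>sign (c 1)\<close>, so the sum factors as
  \<open>(\<Sum>L. sign (r 1) * sign (c 1) * latin_sign L) * (\<Sum>M normalized. row_sign M)\<close>, where \<open>r 1\<close> is the
  first row of \<open>L\<close>.

  The first factor is \<open>n! (n - 1)!\<close> times the signed count of reduced squares: relabel symbols, then
  permute the rows other than the first. For the second, exchange the roles of rows and symbols: \<open>M\<close>
  becomes a square \<open>N\<close> with constant diagonal \<open>1\<close>, and \<open>row_sign M\<close> becomes \<open>latin_sign N\<close> up to the
  sign \<open>(-1) ^ (n (n - 1) / 2)\<close> of the coordinate swap; relabelling the symbols other than \<open>1\<close> gives
  \<open>(n - 1)! AT(n)\<close>.
\<close>

section \<open>Signs of permutations\<close>

lemma sign_power_odd: "odd k \<Longrightarrow> sign p ^ k = sign p"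
  by (cases p rule: sign_cases) auto

lemma sign_inv_permutes: "finite S \<Longrightarrow> p permutes S \<Longrightarrow> sign (inv p) = sign p"
  by (intro sign_inverse permutes_imp_permutation)

lemma sign_comp_permutes:
  "finite S \<Longrightarrow> p permutes S \<Longrightarrow> q permutes S \<Longrightarrow> sign (p \<circ> q) = sign p * sign q"
  by (intro sign_compose permutes_imp_permutation)

lemma bij_betw_fibrewise_iff:
  "bij_betw (\<lambda>(i, j). (i, f i j)) (A \<times> B) (A \<times> C) \<longleftrightarrow> (\<forall>i\<in>A. bij_betw (f i) B C)"
proof
  assume bij: "bij_betw (\<lambda>(i, j). (i, f i j)) (A \<times> B) (A \<times> C)"
  show "\<forall>i\<in>A. bij_betw (f i) B C"
  proof
    fix i assume "i \<in> A"
    have "inj_on (f i) B"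
      using bij \<open>i \<in> A\<close> by (auto simp: bij_betw_def inj_on_def)
    moreover have "f i ` B = C"
    proof -
      have "(\<lambda>(i, j). (i, f i j)) ` (A \<times> B) = A \<times> C"
        using bij by (simp add: bij_betw_def)
      then have "(i, k) \<in> (\<lambda>(i, j). (i, f i j)) ` (A \<times> B) \<longleftrightarrow> k \<in> C" for k
        using \<open>i \<in> A\<close> by simp
      then show ?thesis
        using \<open>i \<in> A\<close> by (auto simp: image_iff)
    qed
    ultimately show "bij_betw (f i) B C"
      by (simp add: bij_betw_def)
  qed
next
  assume "\<forall>i\<in>A. bij_betw (f i) B C"
  then show "bij_betw (\<lambda>(i, j). (i, f i j)) (A \<times> B) (A \<times> C)"
    by (fastforce simp: bij_betw_def inj_on_def image_iff)
qed

lemma sign_on_fibrewise: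
  assumes "finite A" "finite B" "\<And>i. i \<in> A \<Longrightarrow> bij_betw (f i) B B"
  shows "sign_on (A \<times> B) (\<lambda>(i, j). (i, f i j)) = (\<Prod>i\<in>A. sign_on B (f i))"
  using assms(1,3)
proof (induction A rule: finite_induct)
  case empty
  have "restrict_id (\<lambda>(i, j). (i, f i j)) ({} \<times> B) = id"
    by auto
  then show ?case
    by (simp add: sign_on_def)
next
  case (insert a A)
  let ?F = "\<lambda>(i, j). (i, f i j)"
  let ?p = "restrict_id (f a) B"
  have p_permutes: "?p permutes B"
    using insert.prems by (simp add: permutes_restrict_id)
  have inj: "inj_on (Pair a) B"
    by (simp add: inj_on_def)
  have "restrict_id ?F (insert a A \<times> B) = map_permutation B (Pair a) ?p \<circ> restrict_id ?F (A \<times> B)"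
    using insert.hyps(2) inj by (auto simp: fun_eq_iff map_permutation_def restrict_id_def)
  moreover have "map_permutation B (Pair a) ?p permutes Pair a ` B"
    using p_permutes inj by (intro map_permutation_permutes) (auto simp: bij_betw_def)
  then have "permutation (map_permutation B (Pair a) ?p)"
    using assms(2) by (intro permutes_imp_permutation) auto
  moreover have "restrict_id ?F (A \<times> B) permutes A \<times> B"
    using insert.prems by (intro permutes_restrict_id) (simp add: bij_betw_fibrewise_iff)
  then have "permutation (restrict_id ?F (A \<times> B))"
    using assms(2) insert.hyps(1) by (intro permutes_imp_permutation) auto
  ultimately have "sign_on (insert a A \<times> B) ?F = sign ?p * sign_on (A \<times> B) ?F"
    using inj p_permutes assms(2) by (simp only: sign_on_def sign_compose sign_map_permutation)
  then show ?case
    using insert by (simp add: sign_on_def)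
qed

lemma sign_on_involution:
  assumes "finite P" "\<And>x. f (f x) = x" "\<And>x. x \<in> P \<Longrightarrow> f x \<notin> P"
  shows "sign_on (P \<union> f ` P) f = (-1) ^ card P"
  using assms(1,3)
proof (induction P rule: finite_induct)
  case empty
  then show ?case
    by (simp add: sign_on_def restrict_id_def)
next
  case (insert x P)
  let ?f = "restrict_id f (P \<union> f ` P)"
  have "f x \<noteq> x" "f x \<notin> P"
    using insert.prems[of x] by auto
  have "f y = f z \<longleftrightarrow> y = z" for y z
    by (metis assms(2))
  then have "restrict_id f (insert x P \<union> f ` insert x P) = transpose x (f x) \<circ> ?f"
    using insert.hyps \<open>f x \<noteq> x\<close> \<open>f x \<notin> P\<close> assms(2)
    by (auto simp: fun_eq_iff restrict_id_def transpose_def image_iff)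
  moreover have "bij_betw f (P \<union> f ` P) (P \<union> f ` P)"
    using assms(2) by (intro bij_betw_byWitness[where f' = f]) auto
  then have "permutation ?f"
    using insert.hyps(1) by (intro permutes_imp_permutation[OF _ permutes_restrict_id]) auto
  ultimately show ?case
    using insert \<open>f x \<noteq> x\<close>[symmetric]
    by (simp add: sign_on_def sign_compose permutation_swap_id sign_swap_id del: o_apply)
qed

lemma card_less_pairs:
  fixes A :: "'a::linorder set"
  assumes "finite A"
  shows "card {(i, j) \<in> A \<times> A. i < j} = card A choose 2"
proof -
  have "bij_betw (\<lambda>(i, j). {i, j}) {(i, j) \<in> A \<times> A. i < j} {K. K \<subseteq> A \<and> card K = 2}"
    unfolding bij_betw_def
  proof
    show "inj_on (\<lambda>(i, j). {i, j}) {(i, j) \<in> A \<times> A. i < j}"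
      by (auto simp: inj_on_def doubleton_eq_iff)
    show "(\<lambda>(i, j). {i, j}) ` {(i, j) \<in> A \<times> A. i < j} = {K. K \<subseteq> A \<and> card K = 2}"
      by (fastforce simp: card_2_iff image_iff elim: linorder_neqE)
  qed
  then show ?thesis
    using n_subsets[OF assms, of 2] by (simp add: bij_betw_same_card)
qed

lemma sign_on_swap:
  fixes A :: "'a::linorder set"
  assumes "finite A"
  shows "sign_on (A \<times> A) prod.swap = (-1) ^ (card A choose 2)"
proof -
  define P where "P = {(i, j) \<in> A \<times> A. i < j}"
  have "finite P"
    using finite_subset[of P "A \<times> A"] assms by (auto simp: P_def)
  have "restrict_id prod.swap (A \<times> A) = restrict_id prod.swap (P \<union> prod.swap ` P)"
    by (auto simp: fun_eq_iff restrict_id_def P_def image_iff)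
  moreover have "sign_on (P \<union> prod.swap ` P) prod.swap = (-1) ^ card P"
    using \<open>finite P\<close> by (rule sign_on_involution) (auto simp: P_def)
  ultimately show ?thesis
    using card_less_pairs[OF assms] by (simp add: sign_on_def P_def)
qed

section \<open>Tuples of permutations\<close>

text \<open>Below, \<open>{1..n}\<close> is a bare index set: rewriting membership to inequalities or \<open>1\<close> to \<open>Suc 0\<close>
  would keep the simplifier from matching the conditions \<open>i \<in> {1..n}\<close>.\<close>

declare atLeastAtMost_iff [simp del] One_nat_def [simp del]

lemma one_mem_iff [simp]: "1 \<in> {1..n :: nat} \<longleftrightarrow> 0 < n"
  by (simp add: atLeastAtMost_iff Suc_le_eq One_nat_def)

lemma Sym_tuples_iff:
  "\<sigma> \<in> Sym_tuples n \<longleftrightarrow> \<sigma> \<in> extensional {1..n} \<and> (\<forall>i\<in>{1..n}. \<sigma> i permutes {1..n})"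
  by (auto simp: Sym_tuples_def Sym_def PiE_iff)

lemma Sym_tuples_permutes: "\<sigma> \<in> Sym_tuples n \<Longrightarrow> i \<in> {1..n} \<Longrightarrow> \<sigma> i permutes {1..n}"
  by (simp add: Sym_tuples_iff)

lemma Sym_tuples_in_range:
  "\<sigma> \<in> Sym_tuples n \<Longrightarrow> i \<in> {1..n} \<Longrightarrow> j \<in> {1..n} \<Longrightarrow> \<sigma> i j \<in> {1..n}"
  by (simp add: Sym_tuples_permutes permutes_in_image)

lemma finite_Sym_tuples [simp]: "finite (Sym_tuples n)"
  unfolding Sym_tuples_def Sym_def by (intro finite_PiE) (auto intro: finite_permutations)

lemma tuple_sign_cong:
  "(\<And>i. i \<in> {1..n} \<Longrightarrow> \<sigma> i = \<tau> i) \<Longrightarrow> tuple_sign n \<sigma> = tuple_sign n \<tau>"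
  by (simp add: tuple_sign_def)

lemma tuple_sign_mult_self [simp]: "tuple_sign n \<sigma> * tuple_sign n \<sigma> = 1"
  by (simp add: tuple_sign_def flip: prod.distrib)

lemma tuple_sign_nz: "tuple_sign n \<sigma> \<noteq> 0"
  by (simp add: tuple_sign_def)

lemma tuple_sign_const: "tuple_sign n (\<lambda>i. p) = sign p ^ n"
  by (simp add: tuple_sign_def)

lemma tuple_sign_comp:
  assumes "\<And>i. i \<in> {1..n} \<Longrightarrow> \<sigma> i permutes {1..n}" "\<And>i. i \<in> {1..n} \<Longrightarrow> \<tau> i permutes {1..n}"
  shows "tuple_sign n (\<lambda>i. \<sigma> i \<circ> \<tau> i) = tuple_sign n \<sigma> * tuple_sign n \<tau>"
  using assms by (simp add: tuple_sign_def sign_comp_permutes[of "{1..n}"] flip: prod.distrib)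

lemma tuple_sign_inv:
  assumes "\<And>i. i \<in> {1..n} \<Longrightarrow> \<sigma> i permutes {1..n}"
  shows "tuple_sign n (\<lambda>i. inv (\<sigma> i)) = tuple_sign n \<sigma>"
  using assms by (simp add: tuple_sign_def sign_inv_permutes[of "{1..n}"])

lemma tuple_sign_reindex:
  "\<alpha> permutes {1..n} \<Longrightarrow> tuple_sign n (\<lambda>i. \<sigma> (\<alpha> i)) = tuple_sign n \<sigma>"
  unfolding tuple_sign_def by (rule prod.reindex_bij_betw[OF permutes_imp_bij])

lemma tuple_sign_fun_upd:
  "j \<in> {1..n} \<Longrightarrow> tuple_sign n (\<sigma>(j := p)) = sign (\<sigma> j) * sign p * tuple_sign n \<sigma>"
  by (simp add: tuple_sign_def prod.remove[of _ j])

section \<open>Latin squares as arrays\<close>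

definition array :: "nat \<Rightarrow> (nat \<Rightarrow> nat \<Rightarrow> nat) \<Rightarrow> nat \<times> nat \<Rightarrow> nat"
  where "array n f = restrict (\<lambda>(i, j). f i j) ({1..n} \<times> {1..n})"

lemma array_apply [simp]: "i \<in> {1..n} \<Longrightarrow> j \<in> {1..n} \<Longrightarrow> array n f (i, j) = f i j"
  by (simp add: array_def)

lemma array_swap: "array n f \<circ> prod.swap = array n (\<lambda>i j. f j i)"
  by (auto simp: array_def)

lemma bij_betw_iff_ex1:
  "bij_betw f A B \<longleftrightarrow> f \<in> A \<rightarrow> B \<and> (\<forall>y\<in>B. \<exists>!x. x \<in> A \<and> f x = y)"
proof
  assume "bij_betw f A B"
  then show "f \<in> A \<rightarrow> B \<and> (\<forall>y\<in>B. \<exists>!x. x \<in> A \<and> f x = y)"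
    by (auto simp: bij_betw_def dest: inj_onD)
next
  assume "f \<in> A \<rightarrow> B \<and> (\<forall>y\<in>B. \<exists>!x. x \<in> A \<and> f x = y)"
  then show "bij_betw f A B"
    unfolding bij_betw_def inj_on_def by blast
qed

lemma latin_squares_iff:
  "L \<in> latin_squares n \<longleftrightarrow> L \<in> extensional ({1..n} \<times> {1..n}) \<and>
    (\<forall>i\<in>{1..n}. bij_betw (\<lambda>j. L (i, j)) {1..n} {1..n}) \<and>
    (\<forall>j\<in>{1..n}. bij_betw (\<lambda>i. L (i, j)) {1..n} {1..n})"
proof -
  have "(\<forall>j\<in>{1..n}. \<forall>i\<in>{1..n}. L (i, j) \<in> {1..n}) \<longleftrightarrow> (\<forall>i\<in>{1..n}. \<forall>j\<in>{1..n}. L (i, j) \<in> {1..n})"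
    by blast
  then show ?thesis
    unfolding latin_squares_def bij_betw_iff_ex1
    by (simp add: PiE_iff Pi_iff ball_conj_distrib) argo
qed

lemma array_latin_iff:
  "array n f \<in> latin_squares n \<longleftrightarrow>
    (\<forall>i\<in>{1..n}. bij_betw (f i) {1..n} {1..n}) \<and>
    (\<forall>j\<in>{1..n}. bij_betw (\<lambda>i. f i j) {1..n} {1..n})"
proof -
  have "bij_betw (\<lambda>j. array n f (i, j)) {1..n} {1..n} \<longleftrightarrow> bij_betw (f i) {1..n} {1..n}"
    if "i \<in> {1..n}" for i
    using that by (intro bij_betw_cong) simp
  moreover have "bij_betw (\<lambda>i. array n f (i, j)) {1..n} {1..n} \<longleftrightarrow> bij_betw (\<lambda>i. f i j) {1..n} {1..n}"
    if "j \<in> {1..n}" for j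
    using that by (intro bij_betw_cong) simp
  ultimately show ?thesis
    by (simp add: latin_squares_iff) (simp add: array_def)
qed

lemma array_eq_latin:
  assumes "L \<in> latin_squares n" "\<And>i j. i \<in> {1..n} \<Longrightarrow> j \<in> {1..n} \<Longrightarrow> f i j = L (i, j)"
  shows "array n f = L"
  using assms
  by (intro extensionalityI[of _ "{1..n} \<times> {1..n}"]) (auto simp: latin_squares_iff array_def)

lemma latin_in_range:
  "L \<in> latin_squares n \<Longrightarrow> i \<in> {1..n} \<Longrightarrow> j \<in> {1..n} \<Longrightarrow> L (i, j) \<in> {1..n}"
  by (auto simp: latin_squares_def PiE_iff)

lemma finite_latin_squares [simp]: "finite (latin_squares n)"
  by (rule finite_subset[of _ "{1..n} \<times> {1..n} \<rightarrow>\<^sub>E {1..n}"])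
    (auto simp: latin_squares_def intro!: finite_PiE)

lemma latin_squares_swap: "L \<in> latin_squares n \<Longrightarrow> L \<circ> prod.swap \<in> latin_squares n"
  by (auto simp: latin_squares_iff extensional_def)

lemma col_perm_eq_row_perm_swap: "col_perm n L = row_perm n (L \<circ> prod.swap)"
  by (simp add: fun_eq_iff col_perm_def row_perm_def)

lemma row_perm_apply [simp]: "j \<in> {1..n} \<Longrightarrow> row_perm n L i j = L (i, j)"
  by (simp add: row_perm_def)

lemma col_perm_apply [simp]: "i \<in> {1..n} \<Longrightarrow> col_perm n L j i = L (i, j)"
  by (simp add: col_perm_def)

lemma row_perm_permutes: "L \<in> latin_squares n \<Longrightarrow> i \<in> {1..n} \<Longrightarrow> row_perm n L i permutes {1..n}"
  by (simp add: latin_squares_iff row_perm_def permutes_restrict_id)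

lemma col_perm_permutes: "L \<in> latin_squares n \<Longrightarrow> j \<in> {1..n} \<Longrightarrow> col_perm n L j permutes {1..n}"
  by (simp add: col_perm_eq_row_perm_swap latin_squares_swap row_perm_permutes)

lemma inv_col_perm:
  assumes "L \<in> latin_squares n" "i \<in> {1..n}" "j \<in> {1..n}"
  shows inv_col_perm_in_range: "inv (col_perm n L j) i \<in> {1..n}"
    and inv_col_perm_eq_iff: "k \<in> {1..n} \<Longrightarrow> inv (col_perm n L j) i = k \<longleftrightarrow> L (k, j) = i"
  using assms permutes_in_image[OF permutes_inv[OF col_perm_permutes]]
    permutes_inv_eq[OF col_perm_permutes] by auto

lemma row_perm_eqI:
  assumes "p permutes {1..n}" "\<And>j. j \<in> {1..n} \<Longrightarrow> L (i, j) = p j"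
  shows "row_perm n L i = p"
  using assms permutes_not_in[OF assms(1)] by (auto simp: row_perm_def restrict_id_def fun_eq_iff)

lemma row_perm_array:
  "i \<in> {1..n} \<Longrightarrow> f i permutes {1..n} \<Longrightarrow> row_perm n (array n f) i = f i"
  by (rule row_perm_eqI) auto

lemma bij_betw_array_latin:
  "bij_betw (array n) {\<sigma> \<in> Sym_tuples n. array n \<sigma> \<in> latin_squares n} (latin_squares n)"
proof (rule bij_betw_byWitness[where f' = "\<lambda>L. \<lambda>i\<in>{1..n}. row_perm n L i"])
  have rows: "array n (\<lambda>i\<in>{1..n}. row_perm n L i) = L" if "L \<in> latin_squares n" for L
    using that by (rule array_eq_latin) simp
  then show "\<forall>L\<in>latin_squares n. array n (\<lambda>i\<in>{1..n}. row_perm n L i) = L"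
    by blast
  show "(\<lambda>L. \<lambda>i\<in>{1..n}. row_perm n L i) ` latin_squares n
      \<subseteq> {\<sigma> \<in> Sym_tuples n. array n \<sigma> \<in> latin_squares n}"
    using rows by (auto simp: Sym_tuples_iff row_perm_permutes)
  show "\<forall>\<sigma>\<in>{\<sigma> \<in> Sym_tuples n. array n \<sigma> \<in> latin_squares n}.
      (\<lambda>i\<in>{1..n}. row_perm n (array n \<sigma>) i) = \<sigma>"
  proof
    fix \<sigma> assume "\<sigma> \<in> {\<sigma> \<in> Sym_tuples n. array n \<sigma> \<in> latin_squares n}"
    then have \<sigma>: "\<sigma> \<in> extensional {1..n}" "\<And>i. i \<in> {1..n} \<Longrightarrow> row_perm n (array n \<sigma>) i = \<sigma> i"
      by (auto simp: Sym_tuples_iff row_perm_array)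
    then show "(\<lambda>i\<in>{1..n}. row_perm n (array n \<sigma>) i) = \<sigma>"
      by (intro extensionalityI[OF restrict_extensional]) simp_all
  qed
qed auto

definition row_sign :: "nat \<Rightarrow> (nat \<times> nat \<Rightarrow> nat) \<Rightarrow> int"
  where "row_sign n L = tuple_sign n (row_perm n L)"

definition col_sign :: "nat \<Rightarrow> (nat \<times> nat \<Rightarrow> nat) \<Rightarrow> int"
  where "col_sign n L = tuple_sign n (col_perm n L)"

lemma latin_sign_eq: "latin_sign n L = row_sign n L * col_sign n L"
  by (simp add: latin_sign_def row_sign_def col_sign_def tuple_sign_def)

lemma row_sign_array: "\<sigma> \<in> Sym_tuples n \<Longrightarrow> row_sign n (array n \<sigma>) = tuple_sign n \<sigma>"
  unfolding row_sign_def by (rule tuple_sign_cong) (simp add: row_perm_array Sym_tuples_permutes)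

lemma row_sign_eq_sign_on:
  assumes "L \<in> latin_squares n"
  shows "row_sign n L = sign_on ({1..n} \<times> {1..n}) (\<lambda>(i, j). (i, L (i, j)))"
proof -
  have "sign_on ({1..n} \<times> {1..n}) (\<lambda>(i, j). (i, L (i, j)))
      = (\<Prod>i\<in>{1..n}. sign_on {1..n} (\<lambda>j. L (i, j)))"
    using assms by (intro sign_on_fibrewise) (auto simp: latin_squares_iff)
  then show ?thesis
    by (simp add: row_sign_def tuple_sign_def row_perm_def sign_on_def)
qed

lemma col_sign_eq_row_sign_swap: "col_sign n L = row_sign n (L \<circ> prod.swap)"
  by (simp add: row_sign_def col_sign_def col_perm_eq_row_perm_swap)

section \<open>Isotopic Latin squares\<close>

definition isotope ::
    "nat \<Rightarrow> (nat \<Rightarrow> nat) \<Rightarrow> (nat \<Rightarrow> nat) \<Rightarrow> (nat \<Rightarrow> nat) \<Rightarrow> (nat \<times> nat \<Rightarrow> nat) \<Rightarrow> nat \<times> nat \<Rightarrow> nat"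
  where "isotope n \<alpha> \<beta> \<gamma> L = array n (\<lambda>i j. \<gamma> (L (\<alpha> i, \<beta> j)))"

lemma isotope_swap: "isotope n \<alpha> \<beta> \<gamma> L \<circ> prod.swap = isotope n \<beta> \<alpha> \<gamma> (L \<circ> prod.swap)"
  by (simp add: isotope_def array_swap)

lemma row_perm_isotope:
  assumes "L \<in> latin_squares n" "\<alpha> permutes {1..n}" "\<beta> permutes {1..n}" "\<gamma> permutes {1..n}"
    and "i \<in> {1..n}"
  shows "row_perm n (isotope n \<alpha> \<beta> \<gamma> L) i = \<gamma> \<circ> row_perm n L (\<alpha> i) \<circ> \<beta>"
  using assms
  by (intro row_perm_eqI permutes_compose row_perm_permutes)
    (auto simp: isotope_def permutes_in_image)

lemma col_perm_isotope:
  assumes "L \<in> latin_squares n" "\<alpha> permutes {1..n}" "\<beta> permutes {1..n}" "\<gamma> permutes {1..n}"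
    and "j \<in> {1..n}"
  shows "col_perm n (isotope n \<alpha> \<beta> \<gamma> L) j = \<gamma> \<circ> col_perm n L (\<beta> j) \<circ> \<alpha>"
  using assms
  by (simp add: col_perm_eq_row_perm_swap isotope_swap row_perm_isotope latin_squares_swap)

lemma isotope_latin:
  assumes "L \<in> latin_squares n" "\<alpha> permutes {1..n}" "\<beta> permutes {1..n}" "\<gamma> permutes {1..n}"
  shows "isotope n \<alpha> \<beta> \<gamma> L \<in> latin_squares n"
proof -
  have rows: "bij_betw (\<lambda>j. \<gamma> (M (\<alpha> i, \<beta> j))) {1..n} {1..n}"
    if "M \<in> latin_squares n" "\<alpha> permutes {1..n}" "\<beta> permutes {1..n}" "i \<in> {1..n}" for M \<alpha> \<beta> i
  proof -
    have "bij_betw (\<lambda>j. M (\<alpha> i, j)) {1..n} {1..n}"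
      using that by (simp add: latin_squares_iff permutes_in_image)
    then have "bij_betw (\<gamma> \<circ> ((\<lambda>j. M (\<alpha> i, j)) \<circ> \<beta>)) {1..n} {1..n}"
      using permutes_imp_bij[OF \<open>\<gamma> permutes {1..n}\<close>] permutes_imp_bij[OF \<open>\<beta> permutes {1..n}\<close>]
      by (intro bij_betw_trans)
    then show ?thesis
      by (simp add: comp_def)
  qed
  show ?thesis
    using rows[of L \<alpha> \<beta>] rows[of "L \<circ> prod.swap" \<beta> \<alpha>] assms
    by (simp add: isotope_def array_latin_iff latin_squares_swap)
qed

lemma isotope_isotope_inv:
  assumes "L \<in> latin_squares n" "\<alpha> permutes {1..n}" "\<beta> permutes {1..n}" "\<gamma> permutes {1..n}"
  shows "isotope n \<alpha> \<beta> \<gamma> (isotope n (inv \<alpha>) (inv \<beta>) (inv \<gamma>) L) = L"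
  unfolding isotope_def[of n \<alpha>]
  using assms by (intro array_eq_latin) (auto simp: isotope_def permutes_in_image permutes_inverses)

lemma bij_betw_isotope:
  assumes "\<alpha> permutes {1..n}" "\<beta> permutes {1..n}" "\<gamma> permutes {1..n}"
  shows "bij_betw (isotope n \<alpha> \<beta> \<gamma>) (latin_squares n) (latin_squares n)"
proof (rule bij_betw_byWitness[where f' = "isotope n (inv \<alpha>) (inv \<beta>) (inv \<gamma>)"])
  note invs = assms[THEN permutes_inv]
  show "\<forall>L\<in>latin_squares n. isotope n (inv \<alpha>) (inv \<beta>) (inv \<gamma>) (isotope n \<alpha> \<beta> \<gamma> L) = L"
    using isotope_isotope_inv[OF _ invs] assms by (simp add: permutes_inv_inv)
  show "\<forall>L\<in>latin_squares n. isotope n \<alpha> \<beta> \<gamma> (isotope n (inv \<alpha>) (inv \<beta>) (inv \<gamma>) L) = L"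
    using isotope_isotope_inv assms by blast
qed (use assms in \<open>auto intro: isotope_latin permutes_inv\<close>)

lemma row_sign_isotope:
  assumes "L \<in> latin_squares n" "\<alpha> permutes {1..n}" "\<beta> permutes {1..n}" "\<gamma> permutes {1..n}"
  shows "row_sign n (isotope n \<alpha> \<beta> \<gamma> L) = (sign \<gamma> * sign \<beta>) ^ n * row_sign n L"
proof -
  have rows: "row_perm n L (\<alpha> i) permutes {1..n}" if "i \<in> {1..n}" for i
    using assms that by (simp add: row_perm_permutes permutes_in_image)
  have "row_sign n (isotope n \<alpha> \<beta> \<gamma> L) = tuple_sign n (\<lambda>i. \<gamma> \<circ> row_perm n L (\<alpha> i) \<circ> \<beta>)"
    unfolding row_sign_def using assms by (intro tuple_sign_cong) (simp add: row_perm_isotope)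
  also have "\<dots> = sign \<gamma> ^ n * tuple_sign n (\<lambda>i. row_perm n L (\<alpha> i)) * sign \<beta> ^ n"
    using assms rows by (simp add: tuple_sign_comp tuple_sign_const permutes_compose)
  also have "tuple_sign n (\<lambda>i. row_perm n L (\<alpha> i)) = row_sign n L"
    unfolding row_sign_def using assms(2) by (rule tuple_sign_reindex)
  finally show ?thesis
    by (simp add: power_mult_distrib)
qed

lemma latin_sign_isotope:
  assumes "L \<in> latin_squares n" "\<alpha> permutes {1..n}" "\<beta> permutes {1..n}" "\<gamma> permutes {1..n}"
  shows "latin_sign n (isotope n \<alpha> \<beta> \<gamma> L) = (sign \<alpha> * sign \<beta>) ^ n * latin_sign n L"
proof -
  have "col_sign n (isotope n \<alpha> \<beta> \<gamma> L) = (sign \<gamma> * sign \<alpha>) ^ n * col_sign n L"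
    using assms
    by (simp add: col_sign_eq_row_sign_swap isotope_swap row_sign_isotope latin_squares_swap)
  moreover have "sign \<gamma> ^ n * sign \<gamma> ^ n = 1"
    by (simp flip: power_mult_distrib)
  ultimately show ?thesis
    using row_sign_isotope[OF assms] by (simp add: latin_sign_eq power_mult_distrib)
qed

section \<open>The conjugate exchanging rows and symbols\<close>

definition row_symbol_conjugate :: "nat \<Rightarrow> (nat \<times> nat \<Rightarrow> nat) \<Rightarrow> nat \<times> nat \<Rightarrow> nat"
  where "row_symbol_conjugate n M = array n (\<lambda>i j. inv (col_perm n M j) i)"

lemma row_symbol_conjugate_in_range:
  assumes "M \<in> latin_squares n" "i \<in> {1..n}" "j \<in> {1..n}"
  shows "row_symbol_conjugate n M (i, j) \<in> {1..n}"
  using assms by (simp add: row_symbol_conjugate_def inv_col_perm_in_range)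

lemma row_symbol_conjugate_eq_iff:
  assumes "M \<in> latin_squares n" "i \<in> {1..n}" "j \<in> {1..n}" "k \<in> {1..n}"
  shows "row_symbol_conjugate n M (i, j) = k \<longleftrightarrow> M (k, j) = i"
  using assms by (simp add: row_symbol_conjugate_def inv_col_perm_eq_iff)

lemma row_symbol_conjugate_latin:
  assumes "M \<in> latin_squares n"
  shows "row_symbol_conjugate n M \<in> latin_squares n"
proof -
  let ?N = "row_symbol_conjugate n M"
  have "?N \<in> {1..n} \<times> {1..n} \<rightarrow>\<^sub>E {1..n}"
    using row_symbol_conjugate_in_range[OF assms]
    by (auto simp: PiE_iff row_symbol_conjugate_def[of n M] array_def)
  moreover have "\<exists>!j. j \<in> {1..n} \<and> ?N (i, j) = k" if "i \<in> {1..n}" "k \<in> {1..n}" for i k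
    using assms that by (simp add: row_symbol_conjugate_eq_iff latin_squares_def cong: conj_cong)
  moreover have "\<exists>!i. i \<in> {1..n} \<and> ?N (i, j) = k" if "j \<in> {1..n}" "k \<in> {1..n}" for j k
    using assms that latin_in_range[of M n k j]
    by (auto simp: row_symbol_conjugate_eq_iff cong: conj_cong)
  ultimately show ?thesis
    by (simp add: latin_squares_def)
qed

lemma row_symbol_conjugate_involution:
  assumes "M \<in> latin_squares n"
  shows "row_symbol_conjugate n (row_symbol_conjugate n M) = M"
  unfolding row_symbol_conjugate_def[of n "row_symbol_conjugate n M"]
proof (rule array_eq_latin[OF assms])
  fix i j assume "i \<in> {1..n}" "j \<in> {1..n}"
  then show "inv (col_perm n (row_symbol_conjugate n M) j) i = M (i, j)"
    using assms
    by (simp add: permutes_inv_eq[OF col_perm_permutes] row_symbol_conjugate_latin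
        row_symbol_conjugate_eq_iff latin_in_range)
qed

lemma bij_betw_row_symbol_conjugate:
  "bij_betw (row_symbol_conjugate n) (latin_squares n) (latin_squares n)"
  by (rule bij_betw_byWitness[where f' = "row_symbol_conjugate n"])
    (auto simp: row_symbol_conjugate_involution row_symbol_conjugate_latin)

text \<open>
  Row \<open>k\<close> of \<open>M\<close> sends a column to the row in which the conjugate \<open>N\<close> has the symbol \<open>k\<close> in that
  column. Viewed as permutations of cells, the rows of \<open>M\<close> are therefore a product of the rows and
  columns of \<open>N\<close> and coordinate swaps.
\<close>

lemma row_sign_mult_col_sign_conjugate:
  fixes n M
  defines "N \<equiv> row_symbol_conjugate n M"
  assumes M: "M \<in> latin_squares n"
  shows "row_sign n M * col_sign n N = sign_on ({1..n} \<times> {1..n}) prod.swap * row_sign n N"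
proof -
  let ?A = "{1..n} \<times> {1..n}"
  define rM where "rM = (\<lambda>(i, j). (i, M (i, j)))"
  define rN where "rN = (\<lambda>(i, j). (i, N (i, j)))"
  define cN where "cN = (\<lambda>(j, i). (j, N (i, j)))"
  define \<epsilon> where "\<epsilon> = sign_on ?A prod.swap"
  have N: "N \<in> latin_squares n"
    unfolding N_def using M by (rule row_symbol_conjugate_latin)
  have bij: "bij_betw rM ?A ?A" "bij_betw rN ?A ?A" "bij_betw cN ?A ?A"
    using M N by (simp_all add: rM_def rN_def cN_def bij_betw_fibrewise_iff latin_squares_iff)
  have swap: "bij_betw prod.swap ?A ?A"
    by (simp add: bij_betw_def product_swap)
  have signs: "row_sign n M = sign_on ?A rM" "row_sign n N = sign_on ?A rN"
    "col_sign n N = sign_on ?A cN"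
    using M N by (simp_all add: col_sign_eq_row_sign_swap row_sign_eq_sign_on latin_squares_swap
        rM_def rN_def cN_def)
  have "M (N (i, j), j) = i" if "i \<in> {1..n}" "j \<in> {1..n}" for i j
    using that M row_symbol_conjugate_eq_iff[of M n i j "N (i, j)"] latin_in_range[OF N]
    by (simp add: N_def)
  then have "sign_on ?A (rM \<circ> (prod.swap \<circ> (cN \<circ> prod.swap))) = sign_on ?A (prod.swap \<circ> rN)"
    by (intro sign_on_cong) (auto simp: rM_def rN_def cN_def)
  then have "row_sign n M * (\<epsilon> * (col_sign n N * \<epsilon>)) = \<epsilon> * row_sign n N"
    using bij swap
    by (simp add: signs sign_on_compose bij_betw_trans[where B = ?A] \<epsilon>_def del: o_apply)
  moreover have "\<epsilon> * \<epsilon> = 1"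
    by (simp add: \<epsilon>_def sign_on_def)
  ultimately show ?thesis
    unfolding \<epsilon>_def[symmetric] by (metis mult.assoc mult.commute mult.right_neutral)
qed

lemma row_sign_eq_latin_sign_conjugate:
  assumes "M \<in> latin_squares n"
  shows "row_sign n M = (-1) ^ (n * (n - 1) div 2) * latin_sign n (row_symbol_conjugate n M)"
proof -
  let ?N = "row_symbol_conjugate n M"
  have "row_sign n M = row_sign n M * col_sign n ?N * col_sign n ?N"
    by (simp add: col_sign_def mult.assoc)
  also have "\<dots> = sign_on ({1..n} \<times> {1..n}) prod.swap * latin_sign n ?N"
    unfolding row_sign_mult_col_sign_conjugate[OF assms] by (simp add: latin_sign_eq)
  finally show ?thesis
    by (simp add: sign_on_swap choose_two)
qed

section \<open>Signed counts of Latin squares\<close>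

lemma sum_latin_sign_eq_even_minus_odd:
  assumes "finite S"
  shows "(\<Sum>L\<in>S. latin_sign n L)
    = int (card {L \<in> S. latin_even n L}) - int (card {L \<in> S. latin_odd n L})"
proof -
  have "latin_sign n L = of_bool (latin_even n L) - of_bool (latin_odd n L)" for L
  proof -
    have "latin_sign n L * latin_sign n L
        = (row_sign n L * row_sign n L) * (col_sign n L * col_sign n L)"
      by (simp add: latin_sign_eq)
    also have "\<dots> = 1"
      by (simp add: row_sign_def col_sign_def)
    finally have "latin_sign n L = 1 \<or> latin_sign n L = -1"
      by (simp add: zmult_eq_1_iff)
    then show ?thesis
      by (auto simp: latin_even_def latin_odd_def)
  qed
  then have "(\<Sum>L\<in>S. latin_sign n L)
      = (\<Sum>L\<in>S. of_bool (latin_even n L)) - (\<Sum>L\<in>S. of_bool (latin_odd n L))"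
    by (simp add: sum_subtractf)
  then show ?thesis
    using assms by (simp add: Int_def)
qed

lemma AT_eq_sum:
  "AT n = (\<Sum>L | L \<in> latin_squares n \<and> normalized n L \<and> unipotent n L. latin_sign n L)"
  by (simp add: sum_latin_sign_eq_even_minus_odd AT_def U_even_def U_odd_def conj_assoc)

lemma R_even_minus_R_odd_eq_sum:
  "int (R_even n) - int (R_odd n) = (\<Sum>L | L \<in> latin_squares n \<and> reduced n L. latin_sign n L)"
  by (simp add: sum_latin_sign_eq_even_minus_odd R_even_def R_odd_def conj_assoc)

lemma sum_eq_card_times_sum_fibre:
  fixes h :: "'a \<Rightarrow> 'c::semiring_1"
  assumes "finite S" "finite T" "label \<in> S \<rightarrow> T"
    and "\<And>t. t \<in> T \<Longrightarrow> bij_betw (g t) F {x \<in> S. label x = t}"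
    and "\<And>t x. t \<in> T \<Longrightarrow> x \<in> F \<Longrightarrow> h (g t x) = h' x"
  shows "sum h S = of_nat (card T) * sum h' F"
proof -
  have "sum h S = (\<Sum>t\<in>T. \<Sum>x | x \<in> S \<and> label x = t. h x)"
    using assms(1-3) by (intro sum.group[symmetric]) auto
  also have "\<dots> = (\<Sum>t\<in>T. \<Sum>x\<in>F. h (g t x))"
    using assms(4) by (intro sum.cong refl sum.reindex_bij_betw[symmetric])
  also have "\<dots> = (\<Sum>t\<in>T. sum h' F)"
    using assms(5) by (intro sum.cong) auto
  finally show ?thesis
    by simp
qed

lemma permutes_Diff_singleton_iff: "p permutes S - {a} \<longleftrightarrow> p permutes S \<and> p a = a"
  by (auto intro: permutes_subset permutes_superset permutes_not_in)

lemma bij_betw_isotope_first_row: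
  assumes "0 < n" "\<pi> permutes {1..n}"
  shows "bij_betw (isotope n id id \<pi>)
    {L \<in> latin_squares n. normalized n L} {L \<in> latin_squares n. row_perm n L 1 = \<pi>}"
proof (rule bij_betw_Collect[OF bij_betw_isotope])
  fix L assume "L \<in> latin_squares n"
  then have "row_perm n (isotope n id id \<pi> L) 1 = \<pi> \<circ> row_perm n L 1"
    using assms by (simp add: row_perm_isotope)
  then show "row_perm n (isotope n id id \<pi> L) 1 = \<pi> \<longleftrightarrow> normalized n L"
    using inj_eq[OF permutes_inj[OF assms(2)]] by (simp add: normalized_def fun_eq_iff)
qed (use assms in auto)

lemma bij_betw_isotope_first_col:
  assumes "0 < n" "\<alpha> permutes {1..n} - {1}"
  shows "bij_betw (isotope n \<alpha> id id) {L \<in> latin_squares n. reduced n L}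
    {L \<in> latin_squares n. normalized n L \<and> col_perm n L 1 = \<alpha>}"
proof (rule bij_betw_Collect[OF bij_betw_isotope])
  have \<alpha>: "\<alpha> permutes {1..n}" "\<alpha> 1 = 1"
    using assms(2) by (simp_all add: permutes_Diff_singleton_iff)
  then show "\<alpha> permutes {1..n}"
    by simp
  fix L assume "L \<in> latin_squares n"
  then have "row_perm n (isotope n \<alpha> id id L) 1 = row_perm n L 1"
    "col_perm n (isotope n \<alpha> id id L) 1 = col_perm n L 1 \<circ> \<alpha>"
    using assms(1) \<alpha> by (simp_all add: row_perm_isotope col_perm_isotope)
  moreover have "p \<circ> \<alpha> = \<alpha> \<longleftrightarrow> p = id" for p
    using permutes_inv_o(1)[OF \<alpha>(1)] by (metis comp_assoc comp_id id_comp)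
  ultimately show "normalized n (isotope n \<alpha> id id L) \<and> col_perm n (isotope n \<alpha> id id L) 1 = \<alpha>
      \<longleftrightarrow> reduced n L"
    by (simp add: normalized_def reduced_def)
qed auto

lemma normalized_iff: "normalized n L \<longleftrightarrow> (\<forall>j\<in>{1..n}. L (1, j) = j)"
  by (auto simp: normalized_def row_perm_def restrict_id_def fun_eq_iff)

lemma bij_betw_isotope_diagonal_one:
  assumes "0 < n" "\<alpha> permutes {1..n} - {1}"
  shows "bij_betw (isotope n id id \<alpha>) {L \<in> latin_squares n. normalized n L \<and> unipotent n L}
    {L \<in> latin_squares n. row_perm n L 1 = \<alpha> \<and> (\<forall>i\<in>{1..n}. L (i, i) = 1)}"
proof -
  have \<alpha>: "\<alpha> permutes {1..n}" "\<alpha> 1 = 1"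
    using assms(2) by (simp_all add: permutes_Diff_singleton_iff)
  then have "\<alpha> x = 1 \<longleftrightarrow> x = 1" for x
    using inj_eq[OF permutes_inj[OF \<alpha>(1)], of x 1] by simp
  moreover have "unipotent n L \<longleftrightarrow> (\<forall>i\<in>{1..n}. L (i, i) = 1)" if "normalized n L" for L
  proof -
    have "L (1, 1) = 1"
      using that assms(1) by (simp add: normalized_iff)
    then show ?thesis
      using assms(1) by (metis one_mem_iff unipotent_def)
  qed
  ultimately have "(\<forall>i\<in>{1..n}. isotope n id id \<alpha> L (i, i) = 1) \<longleftrightarrow> unipotent n L"
    if "L \<in> {L \<in> latin_squares n. normalized n L}" for L
    using that by (simp add: isotope_def)
  then have "bij_betw (isotope n id id \<alpha>)
      {L \<in> {L \<in> latin_squares n. normalized n L}. unipotent n L}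
      {L \<in> {L \<in> latin_squares n. row_perm n L 1 = \<alpha>}. \<forall>i\<in>{1..n}. L (i, i) = 1}"
    by (rule bij_betw_Collect[OF bij_betw_isotope_first_row[OF assms(1) \<alpha>(1)]])
  then show ?thesis
    by (simp add: conj_assoc)
qed

lemma sum_latin_sign_diagonal_one:
  assumes "0 < n"
  shows "(\<Sum>N | N \<in> latin_squares n \<and> (\<forall>i\<in>{1..n}. N (i, i) = 1). latin_sign n N)
    = fact (n - 1) * AT n"
proof -
  let ?S = "{N \<in> latin_squares n. \<forall>i\<in>{1..n}. N (i, i) = 1}"
  let ?T = "{\<alpha>. \<alpha> permutes {1..n} - {1}}"
  let ?F = "{L \<in> latin_squares n. normalized n L \<and> unipotent n L}"
  have "(\<Sum>N\<in>?S. latin_sign n N) = int (card ?T) * (\<Sum>L\<in>?F. latin_sign n L)"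
  proof (rule sum_eq_card_times_sum_fibre[where g = "isotope n id id"])
    show "(\<lambda>N. row_perm n N 1) \<in> ?S \<rightarrow> ?T"
      using assms by (auto simp: permutes_Diff_singleton_iff row_perm_permutes)
    show "bij_betw (isotope n id id \<alpha>) ?F {N \<in> ?S. row_perm n N 1 = \<alpha>}" if "\<alpha> \<in> ?T" for \<alpha>
      using bij_betw_isotope_diagonal_one[OF assms, of \<alpha>] that by (simp add: conj_ac)
    show "latin_sign n (isotope n id id \<alpha> L) = latin_sign n L" if "\<alpha> \<in> ?T" "L \<in> ?F" for \<alpha> L
      using that by (simp add: latin_sign_isotope permutes_Diff_singleton_iff)
  qed (auto intro: finite_permutations)
  also have "card ?T = fact (n - 1)"
    using assms by (intro card_permutations) auto
  finally show ?thesis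
    by (simp add: AT_eq_sum)
qed

lemma sum_row_sign_normalized:
  assumes "0 < n"
  shows "(\<Sum>M | M \<in> latin_squares n \<and> normalized n M. row_sign n M)
    = (-1) ^ (n * (n - 1) div 2) * fact (n - 1) * AT n"
proof -
  let ?D = "{N \<in> latin_squares n. \<forall>j\<in>{1..n}. N (j, j) = 1}"
  let ?e = "(-1) ^ (n * (n - 1) div 2) :: int"
  have "bij_betw (row_symbol_conjugate n) {M \<in> latin_squares n. normalized n M} ?D"
    by (rule bij_betw_Collect[OF bij_betw_row_symbol_conjugate])
      (use assms in \<open>simp add: row_symbol_conjugate_eq_iff normalized_iff\<close>)
  then have "(\<Sum>N\<in>?D. ?e * latin_sign n N)
      = (\<Sum>M | M \<in> latin_squares n \<and> normalized n M. ?e * latin_sign n (row_symbol_conjugate n M))"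
    by (rule sum.reindex_bij_betw[symmetric])
  also have "\<dots> = (\<Sum>M | M \<in> latin_squares n \<and> normalized n M. row_sign n M)"
    by (intro sum.cong) (auto simp: row_sign_eq_latin_sign_conjugate)
  finally show ?thesis
    using sum_latin_sign_diagonal_one[OF assms] by (simp flip: sum_distrib_left)
qed

lemma sum_row_sign_first_row:
  assumes "odd n" "\<pi> permutes {1..n}"
  shows "(\<Sum>M | M \<in> latin_squares n \<and> row_perm n M 1 = \<pi>. row_sign n M)
    = sign \<pi> * (\<Sum>M | M \<in> latin_squares n \<and> normalized n M. row_sign n M)"
proof -
  have "(\<Sum>M | M \<in> latin_squares n \<and> row_perm n M 1 = \<pi>. row_sign n M)
      = (\<Sum>M | M \<in> latin_squares n \<and> normalized n M. row_sign n (isotope n id id \<pi> M))"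
    using bij_betw_isotope_first_row[OF odd_pos[OF assms(1)] assms(2)]
    by (rule sum.reindex_bij_betw[symmetric])
  also have "\<dots> = (\<Sum>M | M \<in> latin_squares n \<and> normalized n M. sign \<pi> * row_sign n M)"
    using assms by (intro sum.cong) (auto simp: row_sign_isotope sign_power_odd)
  finally show ?thesis
    by (simp add: sum_distrib_left)
qed

lemma sum_sign_first_col_normalized:
  assumes "odd n"
  shows "(\<Sum>L | L \<in> latin_squares n \<and> normalized n L. sign (col_perm n L 1) * latin_sign n L)
    = fact (n - 1) * (int (R_even n) - int (R_odd n))"
proof -
  note n_pos = odd_pos[OF assms]
  let ?S = "{L \<in> latin_squares n. normalized n L}"
  let ?T = "{\<alpha>. \<alpha> permutes {1..n} - {1}}"
  let ?F = "{L \<in> latin_squares n. reduced n L}"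
  let ?h = "\<lambda>L. sign (col_perm n L 1) * latin_sign n L"
  have "(\<Sum>L\<in>?S. ?h L) = int (card ?T) * (\<Sum>L\<in>?F. latin_sign n L)"
  proof (rule sum_eq_card_times_sum_fibre[where g = "\<lambda>\<alpha>. isotope n \<alpha> id id"])
    show "(\<lambda>L. col_perm n L 1) \<in> ?S \<rightarrow> ?T"
      using n_pos by (auto simp: permutes_Diff_singleton_iff col_perm_permutes normalized_iff)
    show bij: "bij_betw (isotope n \<alpha> id id) ?F {L \<in> ?S. col_perm n L 1 = \<alpha>}" if "\<alpha> \<in> ?T" for \<alpha>
      using bij_betw_isotope_first_col[OF n_pos, of \<alpha>] that by (simp add: conj_assoc)
    show "?h (isotope n \<alpha> id id L) = latin_sign n L" if "\<alpha> \<in> ?T" "L \<in> ?F" for \<alpha> L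
    proof -
      have "col_perm n (isotope n \<alpha> id id L) 1 = \<alpha>"
        using bij_betwE[OF bij[OF that(1)]] that(2) by blast
      then show ?thesis
        using that assms
        by (simp add: latin_sign_isotope permutes_Diff_singleton_iff sign_power_odd)
    qed
  qed (auto intro: finite_permutations)
  also have "card ?T = fact (n - 1)"
    using n_pos by (intro card_permutations) auto
  finally show ?thesis
    by (simp add: R_even_minus_R_odd_eq_sum)
qed

lemma sum_sign_first_row_first_col:
  assumes "odd n"
  shows "(\<Sum>L\<in>latin_squares n. sign (row_perm n L 1) * sign (col_perm n L 1) * latin_sign n L)
    = fact n * fact (n - 1) * (int (R_even n) - int (R_odd n))"
proof -
  note n_pos = odd_pos[OF assms]
  let ?T = "{\<pi>. \<pi> permutes {1..n}}"
  let ?F = "{L \<in> latin_squares n. normalized n L}"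
  let ?h = "\<lambda>L. sign (row_perm n L 1) * sign (col_perm n L 1) * latin_sign n L"
  have "(\<Sum>L\<in>latin_squares n. ?h L)
      = int (card ?T) * (\<Sum>L\<in>?F. sign (col_perm n L 1) * latin_sign n L)"
  proof (rule sum_eq_card_times_sum_fibre[where g = "isotope n id id"])
    show "(\<lambda>L. row_perm n L 1) \<in> latin_squares n \<rightarrow> ?T"
      using n_pos by (auto simp: row_perm_permutes)
    show "bij_betw (isotope n id id \<pi>) ?F {L \<in> latin_squares n. row_perm n L 1 = \<pi>}"
      if "\<pi> \<in> ?T" for \<pi>
      using that n_pos by (simp add: bij_betw_isotope_first_row)
    show "?h (isotope n id id \<pi> L) = sign (col_perm n L 1) * latin_sign n L"
      if "\<pi> \<in> ?T" "L \<in> ?F" for \<pi> L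
      using that n_pos
      by (simp add: row_perm_isotope col_perm_isotope latin_sign_isotope normalized_def
          sign_comp_permutes[of "{1..n}"] col_perm_permutes)
  qed (auto intro: finite_permutations)
  also have "card ?T = fact n"
    by (intro card_permutations) auto
  finally show ?thesis
    by (simp add: sum_sign_first_col_normalized[OF assms])
qed

section \<open>Orthogonal mates\<close>

text \<open>Here \<open>\<sigma>\<close> lists the rows of an array and \<open>\<rho>\<close> the columns of one superimposed on it.\<close>

definition orthogonal :: "nat \<Rightarrow> (nat \<Rightarrow> nat \<Rightarrow> nat) \<Rightarrow> (nat \<Rightarrow> nat \<Rightarrow> nat) \<Rightarrow> bool"
  where "orthogonal n \<sigma> \<rho> \<longleftrightarrow>
    bij_betw (\<lambda>(i, j). (\<sigma> i j, \<rho> j i)) ({1..n} \<times> {1..n}) ({1..n} \<times> {1..n})"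

definition mates :: "nat \<Rightarrow> (nat \<Rightarrow> nat \<Rightarrow> nat) \<Rightarrow> (nat \<Rightarrow> nat \<Rightarrow> nat) set"
  where "mates n \<sigma> = {\<rho> \<in> Sym_tuples n. \<rho> 1 = id \<and> orthogonal n \<sigma> \<rho>}"

definition signed_mate_count :: "nat \<Rightarrow> (nat \<Rightarrow> nat \<Rightarrow> nat) \<Rightarrow> int"
  where "signed_mate_count n \<sigma> = (\<Sum>\<rho>\<in>mates n \<sigma>. tuple_sign n \<rho>)"

lemma Sym_tuples_fun_upd:
  "\<rho> \<in> Sym_tuples n \<Longrightarrow> j \<in> {1..n} \<Longrightarrow> p permutes {1..n} \<Longrightarrow> \<rho>(j := p) \<in> Sym_tuples n"
  by (auto simp: Sym_tuples_iff extensional_def)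

lemma orthogonal_fun_upd_comp:
  assumes "orthogonal n \<sigma> \<rho>" "\<tau> permutes {1..n}" "\<And>i. \<sigma> (\<tau> i) j = \<sigma> i j"
  shows "orthogonal n \<sigma> (\<rho>(j := \<rho> j \<circ> \<tau>))"
proof -
  let ?t = "\<lambda>(i, l). (if l = j then \<tau> i else i, l)"
  have "bij_betw ?t ({1..n} \<times> {1..n}) ({1..n} \<times> {1..n})"
    using assms(2) permutes_inv[OF assms(2)]
    by (intro bij_betwI[where g = "\<lambda>(i, l). (if l = j then inv \<tau> i else i, l)"])
      (auto simp: permutes_in_image permutes_inverses)
  then have "bij_betw ((\<lambda>(i, l). (\<sigma> i l, \<rho> l i)) \<circ> ?t) ({1..n} \<times> {1..n}) ({1..n} \<times> {1..n})"
    using assms(1) unfolding orthogonal_def by (rule bij_betw_trans)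
  moreover have "(\<lambda>(i, l). (\<sigma> i l, \<rho> l i)) \<circ> ?t = (\<lambda>(i, l). (\<sigma> i l, (\<rho>(j := \<rho> j \<circ> \<tau>)) l i))"
    using assms(3) by auto
  ultimately show ?thesis
    by (simp add: orthogonal_def)
qed

lemma mates_fun_upd_comp:
  assumes "\<rho> \<in> mates n \<sigma>" "j \<in> {1..n}" "j \<noteq> 1" "\<tau> permutes {1..n}" "\<And>i. \<sigma> (\<tau> i) j = \<sigma> i j"
  shows "\<rho>(j := \<rho> j \<circ> \<tau>) \<in> mates n \<sigma>"
proof -
  have "\<rho> j \<circ> \<tau> permutes {1..n}"
    using assms(1,2,4) by (auto simp: mates_def intro: permutes_compose Sym_tuples_permutes)
  then show ?thesis
    using assms by (simp add: mates_def Sym_tuples_fun_upd orthogonal_fun_upd_comp)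
qed

lemma tuple_sign_fun_upd_comp:
  assumes "\<rho> \<in> Sym_tuples n" "j \<in> {1..n}" "\<tau> permutes {1..n}"
  shows "tuple_sign n (\<rho>(j := \<rho> j \<circ> \<tau>)) = sign \<tau> * tuple_sign n \<rho>"
  using assms
  by (simp add: tuple_sign_fun_upd sign_comp_permutes[of "{1..n}"] Sym_tuples_permutes)

text \<open>If \<open>\<sigma>\<close> has equal entries in two rows of column \<open>j\<close>, then exchanging the corresponding entries
  of \<open>\<rho> j\<close> is a sign-reversing involution of the mates.\<close>

lemma signed_mate_count_eq_0:
  assumes "j \<in> {1..n}" "j \<noteq> 1" "\<not> inj_on (\<lambda>i. \<sigma> i j) {1..n}"
  shows "signed_mate_count n \<sigma> = 0"
proof -
  obtain a b where ab: "a \<in> {1..n}" "b \<in> {1..n}" "a \<noteq> b" "\<sigma> a j = \<sigma> b j"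
    using assms(3) by (auto simp: inj_on_def)
  define \<tau> where "\<tau> = transpose a b"
  have \<tau>: "\<tau> permutes {1..n}" "sign \<tau> = -1" "\<tau> \<circ> \<tau> = id"
    using ab by (simp_all add: \<tau>_def permutes_swap_id sign_swap_id)
  have \<sigma>\<tau>: "\<sigma> (\<tau> i) j = \<sigma> i j" for i
    using ab(4) by (auto simp: \<tau>_def transpose_def)
  show ?thesis
    unfolding signed_mate_count_def
  proof (rule sum_involution_eq_0[where h = "\<lambda>\<rho>. \<rho>(j := \<rho> j \<circ> \<tau>)"])
    fix \<rho> assume \<rho>: "\<rho> \<in> mates n \<sigma>"
    then have sign: "tuple_sign n (\<rho>(j := \<rho> j \<circ> \<tau>)) = - tuple_sign n \<rho>"
      using assms(1) \<tau> by (simp add: tuple_sign_fun_upd_comp mates_def)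
    then show "tuple_sign n (\<rho>(j := \<rho> j \<circ> \<tau>)) + tuple_sign n \<rho> = 0"
      by simp
    show "\<rho>(j := \<rho> j \<circ> \<tau>) \<noteq> \<rho>"
      using sign tuple_sign_nz[of n \<rho>] by auto
    show "\<rho>(j := \<rho> j \<circ> \<tau>) \<in> mates n \<sigma>"
      using \<rho> assms(1,2) \<tau>(1) \<sigma>\<tau> by (rule mates_fun_upd_comp)
    show "(\<rho>(j := \<rho> j \<circ> \<tau>))(j := (\<rho>(j := \<rho> j \<circ> \<tau>)) j \<circ> \<tau>) = \<rho>"
      by (simp add: comp_assoc \<tau>(3))
  qed
qed

lemma bij_betw_remaining_column:
  assumes "finite A" "a \<in> A"
    and rows: "\<And>i. i \<in> A \<Longrightarrow> bij_betw (f i) A A"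
    and cols: "\<And>j. j \<in> A - {a} \<Longrightarrow> inj_on (\<lambda>i. f i j) A"
  shows "bij_betw (\<lambda>i. f i a) A A"
proof -
  have "k \<in> (\<lambda>i. f i a) ` A" if "k \<in> A" for k
  proof (rule ccontr)
    assume k: "k \<notin> (\<lambda>i. f i a) ` A"
    define pos where "pos i = inv_into A (f i) k" for i
    have pos: "pos i \<in> A" "f i (pos i) = k" if "i \<in> A" for i
      using rows[OF that] \<open>k \<in> A\<close>
      by (auto simp: pos_def bij_betw_def inv_into_into f_inv_into_f)
    then have "pos ` A \<subseteq> A - {a}"
      using k by (auto simp: image_iff)
    moreover have "inj_on pos A"
    proof (rule inj_onI)
      fix i i' assume i: "i \<in> A" "i' \<in> A" "pos i = pos i'"
      then have "f i (pos i') = f i' (pos i')"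
        using pos by metis
      moreover have "inj_on (\<lambda>i. f i (pos i')) A"
        using cols i(2) \<open>pos ` A \<subseteq> A - {a}\<close> by blast
      ultimately show "i = i'"
        using i by (auto dest: inj_onD)
    qed
    ultimately have "card A \<le> card (A - {a})"
      using assms(1) by (intro card_inj_on_le) auto
    then show False
      using card_Diff1_less[OF assms(1,2)] by simp
  qed
  moreover have "(\<lambda>i. f i a) ` A \<subseteq> A"
    using rows assms(2) by (auto simp: bij_betw_def)
  ultimately have "(\<lambda>i. f i a) ` A = A"
    by blast
  then show ?thesis
    using assms(1) by (simp add: bij_betw_def eq_card_imp_inj_on)
qed

lemma array_latin_if_signed_mate_count_nonzero:
  assumes "\<sigma> \<in> Sym_tuples n" "signed_mate_count n \<sigma> \<noteq> 0"
  shows "array n \<sigma> \<in> latin_squares n"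
proof -
  have rows: "bij_betw (\<sigma> i) {1..n} {1..n}" if "i \<in> {1..n}" for i
    using Sym_tuples_permutes[OF assms(1) that] by (rule permutes_imp_bij)
  have inj: "inj_on (\<lambda>i. \<sigma> i j) {1..n}" if "j \<in> {1..n} - {1}" for j
    using signed_mate_count_eq_0[of j n \<sigma>] assms(2) that by auto
  have "bij_betw (\<lambda>i. \<sigma> i j) {1..n} {1..n}" if "j \<in> {1..n}" for j
  proof (cases "j = 1")
    case True
    then show ?thesis
      using bij_betw_remaining_column[of "{1..n}" 1 \<sigma>] rows inj that by simp
  next
    case False
    have "(\<lambda>i. \<sigma> i j) ` {1..n} \<subseteq> {1..n}"
      using assms(1) that by (auto simp: Sym_tuples_in_range)
    then show ?thesis
      using inj[of j] False that by (simp add: bij_betw_def endo_inj_surj)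
  qed
  with rows show ?thesis
    by (simp add: array_latin_iff)
qed

lemma orthogonal_iff_latin:
  assumes L: "array n \<sigma> \<in> latin_squares n" and \<rho>: "\<rho> \<in> Sym_tuples n"
  shows "orthogonal n \<sigma> \<rho> \<longleftrightarrow>
    array n (\<lambda>j. \<rho> j \<circ> inv (col_perm n (array n \<sigma>) j)) \<in> latin_squares n"
proof -
  let ?c = "col_perm n (array n \<sigma>)" and ?A = "{1..n} \<times> {1..n}"
  let ?t = "\<lambda>(k, j). (inv (?c j) k, j)"
  have c_permutes: "?c j permutes {1..n}" if "j \<in> {1..n}" for j
    using L that by (rule col_perm_permutes)
  have c_in: "\<sigma> i j \<in> {1..n}" if "i \<in> {1..n}" "j \<in> {1..n}" for i j
    using latin_in_range[OF L that] that by simp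
  have inv_c: "inv (?c j) k \<in> {1..n}" "\<sigma> (inv (?c j) k) j = k" "inv (?c j) (\<sigma> k j) = k"
    if "j \<in> {1..n}" "k \<in> {1..n}" for j k
    using that c_in[OF that(2,1)] inv_col_perm[OF L, of k j]
      inv_col_perm_eq_iff[OF L, of "\<sigma> k j" j k]
    by auto
  have "bij_betw ?t ?A ?A"
    by (rule bij_betwI[where g = "\<lambda>(i, j). (\<sigma> i j, j)"]) (auto simp: inv_c c_in)
  then have "orthogonal n \<sigma> \<rho> \<longleftrightarrow> bij_betw ((\<lambda>(i, j). (\<sigma> i j, \<rho> j i)) \<circ> ?t) ?A ?A"
    unfolding orthogonal_def by (rule bij_betw_comp_iff)
  also have "\<dots> \<longleftrightarrow> bij_betw (\<lambda>(k, j). (k, (\<rho> j \<circ> inv (?c j)) k)) ?A ?A"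
    by (rule bij_betw_cong) (auto simp: inv_c)
  also have "\<dots> \<longleftrightarrow> (\<forall>k\<in>{1..n}. bij_betw (\<lambda>j. (\<rho> j \<circ> inv (?c j)) k) {1..n} {1..n})"
    by (rule bij_betw_fibrewise_iff)
  also have "\<dots> \<longleftrightarrow> array n (\<lambda>j. \<rho> j \<circ> inv (?c j)) \<in> latin_squares n"
  proof -
    have "bij_betw (\<rho> j \<circ> inv (?c j)) {1..n} {1..n}" if "j \<in> {1..n}" for j
      using Sym_tuples_permutes[OF \<rho> that] c_permutes[OF that]
      by (intro permutes_imp_bij permutes_compose permutes_inv)
    then show ?thesis
      by (simp add: array_latin_iff)
  qed
  finally show ?thesis .
qed

lemma bij_betw_Sym_tuples_comp:
  assumes "\<And>j. j \<in> {1..n} \<Longrightarrow> p j permutes {1..n}"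
  shows "bij_betw (\<lambda>\<rho>. \<lambda>j\<in>{1..n}. \<rho> j \<circ> p j) (Sym_tuples n) (Sym_tuples n)"
proof (rule bij_betwI[where g = "\<lambda>\<rho>. \<lambda>j\<in>{1..n}. \<rho> j \<circ> inv (p j)"])
  show "(\<lambda>\<rho>. \<lambda>j\<in>{1..n}. \<rho> j \<circ> p j) \<in> Sym_tuples n \<rightarrow> Sym_tuples n"
    "(\<lambda>\<rho>. \<lambda>j\<in>{1..n}. \<rho> j \<circ> inv (p j)) \<in> Sym_tuples n \<rightarrow> Sym_tuples n"
    using assms by (auto simp: Sym_tuples_iff intro!: permutes_compose permutes_inv)
next
  fix \<rho> assume "\<rho> \<in> Sym_tuples n"
  then have "\<rho> \<in> extensional {1..n}"
    by (simp add: Sym_tuples_iff)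
  then show "(\<lambda>j\<in>{1..n}. (\<lambda>j\<in>{1..n}. \<rho> j \<circ> p j) j \<circ> inv (p j)) = \<rho>"
    "(\<lambda>j\<in>{1..n}. (\<lambda>j\<in>{1..n}. \<rho> j \<circ> inv (p j)) j \<circ> p j) = \<rho>"
    using permutes_inv_o[OF assms]
    by (intro extensionalityI[OF restrict_extensional]; simp add: comp_assoc)+
qed

lemma bij_betw_mates_latin:
  assumes "0 < n" and L: "array n \<sigma> \<in> latin_squares n"
  shows "bij_betw (\<lambda>\<rho>. array n (\<lambda>j\<in>{1..n}. \<rho> j \<circ> inv (col_perm n (array n \<sigma>) j))) (mates n \<sigma>)
    {M \<in> latin_squares n. row_perm n M 1 = inv (col_perm n (array n \<sigma>) 1)}"
proof -
  let ?c = "col_perm n (array n \<sigma>)"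
  let ?g = "\<lambda>\<rho>. \<lambda>j\<in>{1..n}. \<rho> j \<circ> inv (?c j)"
  let ?T = "{\<tau> \<in> Sym_tuples n. array n \<tau> \<in> latin_squares n \<and> \<tau> 1 = inv (?c 1)}"
  let ?S = "{M \<in> latin_squares n. row_perm n M 1 = inv (?c 1)}"
  have c_permutes: "?c j permutes {1..n}" if "j \<in> {1..n}" for j
    using L that by (rule col_perm_permutes)
  have "bij_betw ?g (mates n \<sigma>) ?T"
    unfolding mates_def
  proof (rule bij_betw_Collect[OF bij_betw_Sym_tuples_comp])
    fix \<rho> assume "\<rho> \<in> Sym_tuples n"
    moreover have "array n (?g \<rho>) = array n (\<lambda>j. \<rho> j \<circ> inv (?c j))"
      by (auto simp: array_def)
    moreover have "\<rho> 1 \<circ> inv (?c 1) = inv (?c 1) \<longleftrightarrow> \<rho> 1 = id"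
      using permutes_inv_o(2)[OF c_permutes[of 1]] assms(1)
      by (metis comp_assoc comp_id id_comp one_mem_iff)
    ultimately show "array n (?g \<rho>) \<in> latin_squares n \<and> ?g \<rho> 1 = inv (?c 1)
        \<longleftrightarrow> \<rho> 1 = id \<and> orthogonal n \<sigma> \<rho>"
      using orthogonal_iff_latin[OF L] assms(1) by auto
  qed (use c_permutes in \<open>simp add: permutes_inv\<close>)
  moreover have "bij_betw (array n) ?T ?S"
  proof -
    have "bij_betw (array n)
        {\<tau> \<in> {\<tau> \<in> Sym_tuples n. array n \<tau> \<in> latin_squares n}. \<tau> 1 = inv (?c 1)} ?S"
      by (rule bij_betw_Collect[OF bij_betw_array_latin])
        (use assms(1) in \<open>simp add: row_perm_array Sym_tuples_permutes\<close>)
    then show ?thesis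
      by (simp add: conj_assoc)
  qed
  ultimately have "bij_betw (array n \<circ> ?g) (mates n \<sigma>) ?S"
    by (rule bij_betw_trans)
  then show ?thesis
    by (simp add: comp_def)
qed

lemma signed_mate_count_latin:
  assumes "0 < n" and L: "array n \<sigma> \<in> latin_squares n"
  shows "signed_mate_count n \<sigma> = col_sign n (array n \<sigma>) *
    (\<Sum>M | M \<in> latin_squares n \<and> row_perm n M 1 = inv (col_perm n (array n \<sigma>) 1). row_sign n M)"
proof -
  let ?c = "col_perm n (array n \<sigma>)"
  let ?g = "\<lambda>\<rho>. \<lambda>j\<in>{1..n}. \<rho> j \<circ> inv (?c j)"
  have c_permutes: "?c j permutes {1..n}" if "j \<in> {1..n}" for j
    using L that by (rule col_perm_permutes)
  have "tuple_sign n \<rho> = col_sign n (array n \<sigma>) * row_sign n (array n (?g \<rho>))"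
    if "\<rho> \<in> mates n \<sigma>" for \<rho>
  proof -
    have \<rho>: "\<rho> \<in> Sym_tuples n"
      using that by (simp add: mates_def)
    then have "?g \<rho> \<in> Sym_tuples n"
      using c_permutes by (simp add: Sym_tuples_iff permutes_compose permutes_inv)
    then have "row_sign n (array n (?g \<rho>)) = tuple_sign n (\<lambda>j. \<rho> j \<circ> inv (?c j))"
      by (simp add: row_sign_array cong: tuple_sign_cong)
    also have "\<dots> = tuple_sign n \<rho> * col_sign n (array n \<sigma>)"
      using \<rho> c_permutes
      by (simp add: tuple_sign_comp tuple_sign_inv permutes_inv Sym_tuples_permutes col_sign_def)
    finally show ?thesis
      by (simp add: col_sign_def)
  qed
  then show ?thesis
    unfolding signed_mate_count_def sum_distrib_left
      sum.reindex_bij_betw[OF bij_betw_mates_latin[OF assms], symmetric]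
    by (intro sum.cong refl)
qed

lemma sum_signed_mate_count:
  assumes "odd n"
  shows "(\<Sum>\<sigma>\<in>Sym_tuples n. sign (\<sigma> 1) * tuple_sign n \<sigma> * signed_mate_count n \<sigma>)
    = fact n * (fact (n - 1))\<^sup>2 *
      ((-1) ^ (n * (n - 1) div 2) * (AT n * (int (R_even n) - int (R_odd n))))"
proof -
  note n_pos = odd_pos[OF assms]
  let ?T = "{\<sigma> \<in> Sym_tuples n. array n \<sigma> \<in> latin_squares n}"
  let ?h = "\<lambda>L. sign (row_perm n L 1) * sign (col_perm n L 1) * latin_sign n L"
  define S where "S = (\<Sum>M | M \<in> latin_squares n \<and> normalized n M. row_sign n M)"
  have "(\<Sum>\<sigma>\<in>Sym_tuples n. sign (\<sigma> 1) * tuple_sign n \<sigma> * signed_mate_count n \<sigma>)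
      = (\<Sum>\<sigma>\<in>?T. sign (\<sigma> 1) * tuple_sign n \<sigma> * signed_mate_count n \<sigma>)"
    by (rule sum.mono_neutral_right) (auto dest: array_latin_if_signed_mate_count_nonzero)
  also have "\<dots> = (\<Sum>\<sigma>\<in>?T. ?h (array n \<sigma>) * S)"
  proof (rule sum.cong[OF refl])
    fix \<sigma> assume "\<sigma> \<in> ?T"
    then have \<sigma>: "\<sigma> \<in> Sym_tuples n" and L: "array n \<sigma> \<in> latin_squares n"
      by auto
    have c_permutes: "col_perm n (array n \<sigma>) 1 permutes {1..n}"
      using L n_pos by (simp add: col_perm_permutes)
    have "signed_mate_count n \<sigma> = col_sign n (array n \<sigma>) * (sign (col_perm n (array n \<sigma>) 1) * S)"
      using signed_mate_count_latin[OF n_pos L] c_permutes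
        sum_row_sign_first_row[OF assms permutes_inv[OF c_permutes]]
      by (simp add: S_def sign_inv_permutes[of "{1..n}"])
    moreover have "row_perm n (array n \<sigma>) 1 = \<sigma> 1"
      using \<sigma> n_pos by (simp add: row_perm_array Sym_tuples_permutes)
    ultimately show "sign (\<sigma> 1) * tuple_sign n \<sigma> * signed_mate_count n \<sigma> = ?h (array n \<sigma>) * S"
      using \<sigma> by (simp add: latin_sign_eq row_sign_array)
  qed
  also have "\<dots> = (\<Sum>L\<in>latin_squares n. ?h L) * S"
    unfolding sum_distrib_right using bij_betw_array_latin by (rule sum.reindex_bij_betw)
  finally show ?thesis
    unfolding sum_sign_first_row_first_col[OF assms] S_def sum_row_sign_normalized[OF n_pos]
    by (simp only: power2_eq_square ac_simps)
qed

section \<open>The coefficient of the all-ones monomial\<close>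

lemma mcoeff_sum: "mcoeff (\<Sum>x\<in>S. p x) m = (\<Sum>x\<in>S. mcoeff (p x) m)"
  by (simp add: mcoeff_def lookup_sum)

lemma mcoeff_Const_mult: "mcoeff (Const c * p) m = c * mcoeff p m" for c :: "'a::comm_ring_1"
  unfolding mcoeff_def Const_def mult_map_scale_conv_mult[symmetric]
  by (simp add: Poly_Mapping.map.rep_eq when_def)

lemma mcoeff_of_int_mult:
  "mcoeff (of_int k * p) m = of_int k * mcoeff p m" for p :: "('v, 'a::comm_ring_1) mpoly"
  using mcoeff_Const_mult[of "of_int k" p m] by (simp add: Const_def)

lemma prod_Var:
  "finite A \<Longrightarrow> (\<Prod>a\<in>A. Var (g a) :: ('v, 'a::comm_semiring_1) mpoly)
    = Poly_Mapping.single (\<Sum>a\<in>A. Poly_Mapping.single (g a) 1) 1"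
  by (induction A rule: finite_induct) (simp_all add: Var_def mult_single)

lemma sum_single_eq_iff_bij_betw:
  assumes "finite A" "g ` A \<subseteq> A"
  shows "(\<Sum>a\<in>A. Poly_Mapping.single (g a) (1::nat)) = (\<Sum>a\<in>A. Poly_Mapping.single a 1)
    \<longleftrightarrow> bij_betw g A A"
proof
  assume eq: "(\<Sum>a\<in>A. Poly_Mapping.single (g a) (1::nat)) = (\<Sum>a\<in>A. Poly_Mapping.single a 1)"
  have "y \<in> g ` A" if "y \<in> A" for y
  proof (rule ccontr)
    assume "y \<notin> g ` A"
    then have "(\<Sum>a\<in>A. Poly_Mapping.lookup (Poly_Mapping.single (g a) (1::nat)) y) = 0"
      by (intro sum.neutral) (auto simp: lookup_single when_def)
    moreover have "(\<Sum>a\<in>A. Poly_Mapping.lookup (Poly_Mapping.single a (1::nat)) y) = 1"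
      using assms(1) that by (simp add: lookup_single when_def)
    ultimately show False
      using arg_cong[OF eq, of "\<lambda>p. Poly_Mapping.lookup p y"] by (simp add: lookup_sum)
  qed
  then have "g ` A = A"
    using assms(2) by blast
  then show "bij_betw g A A"
    using assms(1) by (simp add: bij_betw_def eq_card_imp_inj_on)
qed (rule sum.reindex_bij_betw)

lemma mcoeff_prod_Var:
  assumes "finite A" "g ` A \<subseteq> A"
  shows "mcoeff (\<Prod>a\<in>A. Var (g a) :: ('v, 'a::comm_semiring_1) mpoly)
      (\<Sum>a\<in>A. Poly_Mapping.single a 1) = of_bool (bij_betw g A A)"
  using sum_single_eq_iff_bij_betw[OF assms]
  by (simp add: prod_Var assms(1) mcoeff_def lookup_single when_def)

lemma mcoeff_prod_Var_tuples:
  assumes "\<rho> \<in> Sym_tuples n" "\<sigma> \<in> Sym_tuples n"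
  shows "mcoeff (\<Prod>i\<in>{1..n}. \<Prod>j\<in>{1..n}. Var (\<sigma> i j, \<rho> j i)) (all_ones_monomial n)
    = (of_bool (orthogonal n \<sigma> \<rho>) :: 'a::comm_semiring_1)"
proof -
  let ?g = "\<lambda>(i, j). (\<sigma> i j, \<rho> j i)"
  have "?g ` ({1..n} \<times> {1..n}) \<subseteq> {1..n} \<times> {1..n}"
    using assms by (auto simp: Sym_tuples_in_range)
  then show ?thesis
    using mcoeff_prod_Var[of "{1..n} \<times> {1..n}" ?g]
    by (simp add: orthogonal_def all_ones_monomial_def sum.cartesian_product prod.cartesian_product
        case_prod_unfold)
qed

lemma mcoeff_signed_sum:
  "mcoeff (\<Sum>(\<rho>, \<sigma>) \<in> {(\<rho>, \<sigma>). \<rho> \<in> Sym_tuples n \<and> \<sigma> \<in> Sym_tuples n \<and> \<rho> 1 = id}.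
      of_int (sign (\<sigma> 1) * tuple_sign n \<sigma> * tuple_sign n \<rho>) *
      (\<Prod>i\<in>{1..n}. \<Prod>j\<in>{1..n}. Var (\<sigma> i j, \<rho> j i))) (all_ones_monomial n)
    = (of_int (\<Sum>\<sigma>\<in>Sym_tuples n. sign (\<sigma> 1) * tuple_sign n \<sigma> * signed_mate_count n \<sigma>)
      :: 'a::comm_ring_1)"
proof -
  let ?R = "{\<rho> \<in> Sym_tuples n. \<rho> 1 = id}"
  let ?t = "\<lambda>\<sigma> \<rho>. sign (\<sigma> 1) * tuple_sign n \<sigma> * tuple_sign n \<rho>"
  have pairs: "{(\<rho>, \<sigma>). \<rho> \<in> Sym_tuples n \<and> \<sigma> \<in> Sym_tuples n \<and> \<rho> 1 = id} = ?R \<times> Sym_tuples n"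
    by auto
  have "signed_mate_count n \<sigma> = (\<Sum>\<rho>\<in>?R. tuple_sign n \<rho> * of_bool (orthogonal n \<sigma> \<rho>))" for \<sigma>
    unfolding signed_mate_count_def mates_def by (rule sum.mono_neutral_cong_left) auto
  then have expand: "(\<Sum>\<sigma>\<in>Sym_tuples n. sign (\<sigma> 1) * tuple_sign n \<sigma> * signed_mate_count n \<sigma>)
      = (\<Sum>\<rho>\<in>?R. \<Sum>\<sigma>\<in>Sym_tuples n. ?t \<sigma> \<rho> * of_bool (orthogonal n \<sigma> \<rho>))"
    by (simp only: sum_distrib_left mult.assoc) (rule sum.swap)
  show ?thesis
    unfolding pairs sum.cartesian_product[symmetric] mcoeff_sum mcoeff_of_int_mult expand of_int_sum
    by (intro sum.cong refl) (simp add: mcoeff_prod_Var_tuples)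
qed

theorem theorem7:
  fixes n :: nat
  assumes "odd n"
  shows "mcoeff
      (Const (1 / (fact n * (fact (n - 1))\<^sup>2) :: rat) *
        (\<Sum>(\<rho>, \<sigma>) \<in> {(\<rho>, \<sigma>). \<rho> \<in> Sym_tuples n \<and> \<sigma> \<in> Sym_tuples n \<and> \<rho> 1 = id}.
          of_int (sign (\<sigma> 1) * tuple_sign n \<sigma> * tuple_sign n \<rho>) *
          (\<Prod>i\<in>{1..n}. \<Prod>j\<in>{1..n}. Var (\<sigma> i j, \<rho> j i))))
      (all_ones_monomial n)
    = (-1) ^ (n * (n - 1) div 2) * of_int (AT n * (int (R_even n) - int (R_odd n)))"
proof -
  let ?c = "fact n * (fact (n - 1))\<^sup>2 :: int"
  let ?r = "(-1) ^ (n * (n - 1) div 2) * (AT n * (int (R_even n) - int (R_odd n)))"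
  have "(\<Sum>\<sigma>\<in>Sym_tuples n. sign (\<sigma> 1) * tuple_sign n \<sigma> * signed_mate_count n \<sigma>) = ?c * ?r"
    using assms by (rule sum_signed_mate_count)
  moreover have "1 / (fact n * (fact (n - 1))\<^sup>2) * of_int (?c * ?r) = (of_int ?r :: rat)"
    by simp
  ultimately show ?thesis
    unfolding mcoeff_Const_mult mcoeff_signed_sum by simp
qed

end
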